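(* There exist absolute constants $C,K>0$ such that the following holds for all integers $F\ge 1$ and $M\ge 2$ with $M\ge KF$ (the regime $M\gg F$). Let $Q(D)$ denote the number of qubits of the degree-$D$ code for $F$ fermions in $M$ modes (defined in the context), and let $D$ be a positive integer that minimizes $Q(D)$. Then $$Q(D)\le C\,F^2\log^4 M\qquad\text{and}\qquad D\le C\log M ,$$ i.e. in the $M\gg F$ limit the code satisfies $Q=O(F^2\log^4 M)$ with $D=O(\log M)$.
   Context: The degree-$D$ code. Given positive integers $F$ (number of fermions), $M$ (number of modes) and $D$ (degree), put $G=F\lceil\log_2(M+1)\rceil$ and $L=2DG+1$, and let $L'$ be the least prime number such that $L'\ge L$ and $(L')^{D+1}\ge M$. The code uses $Q=Q(D)=L'L$ qubits, partitioned into $L$ blocks of $L'$ qubits each. Choose $M$ distinct polynomial functions of degree at most $D$ over the field $\mathbb{Z}_{L'}$ (there are $(L')^{D+1}\ge M$ of these), one for each of $M$ bits. The "elementary codeword" associated with a polynomial $y$ is the bitstring of length $L'L$ which in block $x\in\{0,\dots,L-1\}$ has exactly one $1$, located at position $y(x)\in\{0,\dots,L'-1\}$. The code maps a bitstring $b\in\{0,1\}^M$ of Hamming weight at most $G$ to the bitwise sum (XOR) of the elementary codewords associated with the positions of the $1$s of $b$. (The relevant bitstrings $b$ are the Bravyi-Kitaev bitstrings representing occupation number states of at most $F$ fermions, all of which have Hamming weight at most $G$.) *)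

theory Defs
  imports Complex_Main "HOL-Computational_Algebra.Primes"
begin

text \<open>
  Parameters of the degree-\<open>D\<close> code for at most \<open>F\<close> fermions in \<open>M\<close> modes. The code uses
  \<open>code_blocks F M D\<close> blocks (the number $L$) of \<open>code_block_size F M D\<close> qubits each (the prime
  $L'$). Each of the \<open>M\<close> input bits is assigned its own polynomial function of degree at most \<open>D\<close> over
  the field with $L'$ elements; \<open>M \<le> p ^ (D + 1)\<close> ensures that there are enough of them. The encoded
  bitstrings have Hamming weight at most \<open>code_weight F M\<close> (the number $G$).
\<close>

definition code_weight :: "nat \<Rightarrow> nat \<Rightarrow> nat" where
  "code_weight F M = F * nat \<lceil>log 2 (real M + 1)\<rceil>"

definition code_blocks :: "nat \<Rightarrow> nat \<Rightarrow> nat \<Rightarrow> nat" where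
  "code_blocks F M D = 2 * D * code_weight F M + 1"

definition code_block_size :: "nat \<Rightarrow> nat \<Rightarrow> nat \<Rightarrow> nat" where
  "code_block_size F M D = (LEAST p. prime p \<and> code_blocks F M D \<le> p \<and> M \<le> p ^ (D + 1))"

definition code_qubits :: "nat \<Rightarrow> nat \<Rightarrow> nat \<Rightarrow> nat" where
  "code_qubits F M D = code_block_size F M D * code_blocks F M D"

lemma code_block_size:
  "prime (code_block_size F M D)"
  "code_blocks F M D \<le> code_block_size F M D"
  "M \<le> code_block_size F M D ^ (D + 1)"
proof -
  obtain p where p: "prime p" "p > max (code_blocks F M D) M"
    using bigger_prime by blast
  have "M \<le> p ^ (D + 1)"
    using p self_le_power[of p "D + 1"] by (simp add: prime_ge_1_nat del: power_Suc)
  with p have "\<exists>p. prime p \<and> code_blocks F M D \<le> p \<and> M \<le> p ^ (D + 1)"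
    by (intro exI[of _ p]) auto
  from LeastI_ex[OF this] show
    "prime (code_block_size F M D)"
    "code_blocks F M D \<le> code_block_size F M D"
    "M \<le> code_block_size F M D ^ (D + 1)"
    unfolding code_block_size_def by auto
qed

end

theory Submission
  imports Defs "HOL-Real_Asymp.Real_Asymp"
begin

text \<open>The number of qubits is at least the square of the number \<open>L\<close> of blocks. For a degree \<open>D\<close> of order
  \<open>log M\<close> the requirement of having \<open>M\<close> polynomials is void, and since there is a prime between \<open>L\<close>
  and a constant multiple of \<open>L\<close>, the number of qubits is \<open>O(L\<^sup>2) = O(F\<^sup>2 log\<^sup>4 M)\<close>. Both bounds follow
  by comparing the optimal degree with this one. The prime is found by Erdos' proof of Bertrand's
  postulate, with the constant left unspecified.\<close>

section \<open>Primes in short intervals\<close>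

text \<open>Induction along the Leibniz harmonic triangle with entries
  \<open>1 / (k * (n choose k))\<close>: each new entry is a difference of two earlier ones, so
  multiplying by \<open>L\<close> keeps it an integer. With \<open>L = Lcm {1..n}\<close> this
  controls the prime powers in \<open>n choose k\<close>.\<close>

lemma mult_binomial_dvd_common_multiple:
  fixes n k L :: nat
  assumes "1 \<le> k" "k \<le> n" "\<And>j. 1 \<le> j \<Longrightarrow> j \<le> n \<Longrightarrow> j dvd L"
  shows "k * (n choose k) dvd L"
  using assms
proof (induction k arbitrary: n rule: nat_induct_at_least)
  case base
  then show ?case by simp
next
  case (Suc k)
  define u v w where "u = k * ((n - 1) choose k)" and "v = k * (n choose k)"
    and "w = Suc k * (n choose Suc k)"
  have "u dvd L" unfolding u_def using Suc.prems by (intro Suc.IH) auto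
  then obtain s where s: "L = u * s" ..
  have "v dvd L" unfolding v_def using Suc.prems by (intro Suc.IH) auto
  then obtain t where t: "L = v * t" ..
  have pos: "u > 0" "v > 0" "w > 0"
    using Suc by (auto simp: u_def v_def w_def)
  obtain m where m: "n = Suc m" using Suc.prems by (cases n) auto
  have w: "w = n * (m choose k)"
    unfolding w_def using binomial_absorption[of k n] by (simp add: m)
  have 1: "k * w = n * u" unfolding w u_def m by (simp add: algebra_simps)
  have "(n - k) * (n choose k) = n * (m choose k)"
    using binomial_absorb_comp[of n k] by (simp add: m)
  hence "(n - k) * v = k * w" unfolding v_def w by simp
  moreover have "w * k + k * v = n * v"
    using calculation Suc.prems by (metis add.commute add_mult_distrib le_add_diff_inverse2 mult.commute Suc_leD)
  ultimately have "w * v = w * u + u * v"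
    \<comment> \<open>the recurrence \<open>1/w = 1/u - 1/v\<close> of the Leibniz harmonic triangle\<close>
  proof -
    have "k * (w * v) = n * v * u" using 1 by (metis mult.assoc mult.commute)
    also have "\<dots> = (w * k + k * v) * u" using \<open>w * k + k * v = n * v\<close> by simp
    finally have "k * (w * v) = k * (w * u + u * v)" by (simp add: algebra_simps)
    thus ?thesis using Suc.hyps by simp
  qed
  \<comment> \<open>Here \<open>s = L / u\<close> and \<open>t = L / v\<close>, so multiplying the
    recurrence by \<open>L\<close> gives \<open>L / w = s - t\<close>.\<close>
  have "real L = real w * (real s - real t)"
  proof -
    have "real w * real v = real w * real u + real u * real v"
      using \<open>w * v = w * u + u * v\<close> by (metis of_nat_add of_nat_mult)
    moreover have "real w * (real L / real u - real L / real v) =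
        real L * ((real w * real v - real w * real u) / (real u * real v))"
      using pos by (simp add: field_simps)
    ultimately have "real w * (real L / real u - real L / real v) = real L"
      using pos by simp
    moreover have "real L / real u = real s" using pos by (subst s) simp
    moreover have "real L / real v = real t" using pos by (subst t) simp
    ultimately show ?thesis by simp
  qed
  hence "real_of_int (int L) = real_of_int (int w * (int s - int t))" by simp
  hence "int L = int w * (int s - int t)" by (simp only: of_int_eq_iff)
  hence "int w dvd int L" by simp
  thus ?case unfolding w_def by presburger
qed

text \<open>The multiplicity of \<open>p\<close> in a least common multiple is the maximum over the
  members, so some member attains it. The condition \<open>e > 0\<close> excludes the empty set,
  whose \<open>Lcm\<close> is 1.\<close>

lemma prime_power_dvd_Lcm_natE:
  fixes p :: nat
  assumes "finite A" "0 \<notin> A" "prime p" "p ^ e dvd Lcm A" "e > 0"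
  obtains a where "a \<in> A" "p ^ e dvd a"
proof -
  have "\<exists>a\<in>A. p ^ e dvd a"
    using assms(1,2,4)
  proof (induction A rule: finite_induct)
    case empty
    then show ?case using assms(3,5) by (simp add: prime_nat_iff)
  next
    case (insert a A)
    have nz: "a \<noteq> 0" "Lcm A \<noteq> 0"
      using insert by (auto simp: Lcm_0_iff)
    have "count (prime_factorization (lcm a (Lcm A))) p
        = max (multiplicity p a) (multiplicity p (Lcm A))"
      using nz \<open>prime p\<close> by (simp add: prime_factorization_lcm count_prime_factorization_prime)
    hence "multiplicity p (lcm a (Lcm A)) = max (multiplicity p a) (multiplicity p (Lcm A))"
      using \<open>prime p\<close> by (simp add: count_prime_factorization_prime)
    moreover have "e \<le> multiplicity p (lcm a (Lcm A))"
      using insert.prems nz \<open>prime p\<close> by (intro multiplicity_geI) (auto simp: prime_nat_iff lcm_eq_0_iff)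
    ultimately have "e \<le> multiplicity p a \<or> e \<le> multiplicity p (Lcm A)" by auto
    thus ?case using insert by (auto dest: multiplicity_dvd')
  qed
  thus ?thesis using that by blast
qed

text \<open>Such a prime power divides \<open>Lcm {1..n}\<close>, hence a single number in
  \<open>{1..n}\<close>.\<close>

lemma prime_power_dvd_binomial_le:
  fixes p :: nat
  assumes "prime p" "p ^ e dvd (n choose k)" "k \<le> n" "n > 0"
  shows "p ^ e \<le> n"
proof (cases "k = 0 \<or> e = 0")
  case True
  hence "p ^ e dvd 1" using assms(2) by auto
  hence "p ^ e = 1" by simp
  then show ?thesis using assms(4) by linarith
next
  case False
  have "k * (n choose k) dvd Lcm {1..n}"
    using False assms by (intro mult_binomial_dvd_common_multiple) (auto intro!: dvd_Lcm)
  hence "p ^ e dvd Lcm {1..n}" using assms by (meson dvd_mult dvd_trans)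
  then obtain a where "a \<in> {1..n}" "p ^ e dvd a"
    using prime_power_dvd_Lcm_natE[of "{1..n}" p e] assms False by auto
  thus ?thesis using dvd_imp_le[of "p ^ e" a] by auto
qed

section \<open>The product of the primes up to \<open>n\<close>\<close>

lemma prod_primes_dvd:
  fixes A :: "nat set"
  assumes "finite A" "\<And>p. p \<in> A \<Longrightarrow> prime p" "\<And>p. p \<in> A \<Longrightarrow> p dvd x"
  shows "\<Prod>A dvd x"
  using assms
proof (induction A rule: finite_induct)
  case (insert p A)
  have "coprime p (\<Prod>A)"
    using insert by (intro prod_coprime_right) (auto intro!: primes_coprime)
  thus ?case using insert by (auto intro!: divides_mult)
qed simp

lemma binomial_odd_middle_le: "(2 * m + 1) choose m \<le> 4 ^ m"
proof -
  \<comment> \<open>The two middle entries of this row are equal, and the whole row sums to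
    \<open>2 * 4 ^ m\<close>.\<close>
  have "2 * ((2 * m + 1) choose m) = ((2 * m + 1) choose m) + ((2 * m + 1) choose (m + 1))"
    using binomial_symmetric[of m "2 * m + 1"] by simp
  also have "\<dots> = (\<Sum>k\<in>{m, m + 1}. (2 * m + 1) choose k)" by simp
  also have "\<dots> \<le> (\<Sum>k\<le>2 * m + 1. (2 * m + 1) choose k)" by (intro sum_mono2) auto
  also have "\<dots> = 2 * 4 ^ m" using choose_row_sum[of "2 * m + 1"] by (simp add: power_mult)
  finally show ?thesis by simp
qed

text \<open>Strong induction. For \<open>n = 2 * m + 1\<close> the primes up to \<open>m + 1\<close>
  contribute at most \<open>4 ^ (m + 1)\<close>, and those above it all divide
  \<open>n choose m\<close>, which is at most \<open>4 ^ m\<close>.\<close>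

lemma prod_primes_atMost_le: "\<Prod>{p::nat. prime p \<and> p \<le> n} \<le> 4 ^ n"
proof (induction n rule: less_induct)
  case (less n)
  consider "n \<le> 1" | "n = 2" | "n > 2" "even n" | m where "m \<ge> 1" "n = 2 * m + 1"
  proof -
    have "\<exists>m\<ge>1. n = 2 * m + 1" if "n > 2" "odd n" using that by (auto elim!: oddE)
    moreover have "n \<le> 1 \<or> n = 2 \<or> n > 2" by linarith
    ultimately show ?thesis using that by blast
  qed
  thus ?case
  proof cases
    case 1
    have "{p::nat. prime p \<and> p \<le> n} = {}" using 1 by (auto dest: prime_ge_2_nat)
    thus ?thesis by (simp only:) simp
  next
    case 2
    have "{p::nat. prime p \<and> p \<le> n} = {2}" using 2 by (auto dest: prime_ge_2_nat)
    thus ?thesis using 2 by (simp only:) simp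
  next
    case 3
    have "\<not> prime n" using 3 primes_dvd_imp_eq[of 2 n] by auto
    hence "prime p \<and> p \<le> n \<longleftrightarrow> prime p \<and> p \<le> n - 1" for p
      using 3 by (cases "p = n") auto
    hence "{p::nat. prime p \<and> p \<le> n} = {p. prime p \<and> p \<le> n - 1}" by blast
    also have "\<Prod>\<dots> \<le> 4 ^ (n - 1)" using 3 by (intro less.IH) auto
    also have "\<dots> \<le> 4 ^ n" by (intro power_increasing) auto
    finally show ?thesis .
  next
    case (4 m)
    let ?A = "{p::nat. prime p \<and> p \<le> m + 1}" and ?B = "{p::nat. prime p \<and> m + 1 < p \<and> p \<le> n}"
    have "\<Prod>?B dvd (n choose m)"
    proof (rule prod_primes_dvd)
      fix p assume p: "p \<in> ?B"
      \<comment> \<open>The product is \<open>fact n\<close>; since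
        \<open>p > m + 1 = n - m\<close>, neither factorial on the left absorbs
        \<open>p\<close>.\<close>
      have "p dvd fact m * fact (n - m) * (n choose m)"
        using p 4 by (subst binomial_fact_lemma) (simp_all add: prime_dvd_fact_iff del: fact_Suc)
      thus "p dvd (n choose m)"
        using p 4 by (auto simp: prime_dvd_mult_iff prime_dvd_fact_iff simp del: fact_Suc binomial_Suc_Suc)
    qed auto
    hence "\<Prod>?B \<le> n choose m" using 4 by (intro dvd_imp_le) auto
    also have "\<dots> \<le> 4 ^ m" using binomial_odd_middle_le[of m] 4 by simp
    finally have B: "\<Prod>?B \<le> 4 ^ m" .
    have "\<Prod>?A \<le> 4 ^ (m + 1)" using 4 by (intro less.IH) simp
    hence "\<Prod>?A * \<Prod>?B \<le> 4 ^ (m + 1) * 4 ^ m" using B by (rule mult_le_mono)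
    moreover have "{p::nat. prime p \<and> p \<le> n} = ?A \<union> ?B" using 4 by auto
    moreover have "\<Prod>(?A \<union> ?B) = \<Prod>?A * \<Prod>?B" by (intro prod.union_disjoint) auto
    moreover have "n = m + 1 + m" using 4 by simp
    ultimately show ?thesis by (simp only: power_add)
  qed
qed

section \<open>Primes in \<open>(n, 4n]\<close> and the constant \<open>B\<close>\<close>

text \<open>Without primes in \<open>(n, 4n]\<close>, the prime factors of the central binomial coefficient of \<open>4n\<close>
  above \<open>\<surd>(4n)\<close> are simple and at most \<open>n\<close>, so the coefficient would be too small.\<close>

lemma central_binomial_le_if_no_prime:
  fixes n :: nat
  assumes n: "n \<ge> 1" and no: "\<And>p. prime p \<Longrightarrow> n < p \<Longrightarrow> \<not> p \<le> 4 * n"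
  shows "real (4 * n choose (2 * n)) \<le> (4 * real n) powr (2 * sqrt n) * 4 ^ n"
proof -
  define X where "X = (4 * n) choose (2 * n)"
  have X0: "X > 0" by (simp add: X_def)
  have pp: "p ^ multiplicity p X \<le> 4 * n" if "prime p" for p
    using that n multiplicity_dvd[of p X]
    by (intro prime_power_dvd_binomial_le[of p _ "4 * n" "2 * n"]) (auto simp: X_def)
  define S where "S = {p \<in> prime_factors X. p ^ 2 \<le> 4 * n}"
  define T where "T = {p \<in> prime_factors X. p ^ 2 > 4 * n}"
  have le_n: "p \<le> n" if "p \<in> prime_factors X" for p
  proof -
    have p: "prime p" "p dvd X" using that by auto
    have "p ^ 1 \<le> 4 * n" by (rule prime_power_dvd_binomial_le[of p _ _ "2 * n"]) (use p n in \<open>auto simp: X_def\<close>)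
    thus ?thesis using no[OF p(1)] by force
  qed
  have "prod (\<lambda>p. p ^ multiplicity p X) T \<le> \<Prod>T"
  proof (intro prod_mono conjI)
    fix p assume p: "p \<in> T"
    hence "prime p" by (auto simp: T_def)
    \<comment> \<open>Otherwise \<open>p ^ 2 > 4 * n\<close> would contradict the bound
      \<open>pp\<close> on prime powers in \<open>X\<close>.\<close>
    have "\<not> multiplicity p X \<ge> 2"
      using pp[OF \<open>prime p\<close>] p power_increasing[of 2 "multiplicity p X" p] prime_ge_1_nat[OF \<open>prime p\<close>]
      by (force simp: T_def)
    hence "p ^ multiplicity p X \<le> p ^ 1"
      using prime_ge_1_nat[OF \<open>prime p\<close>] by (intro power_increasing) auto
    thus "p ^ multiplicity p X \<le> p" by simp
  qed auto
  also have "\<Prod>T \<le> \<Prod>{p. prime p \<and> p \<le> n}"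
    by (intro dvd_imp_le prod_dvd_prod_subset prod_pos) (auto simp: T_def le_n prime_gt_0_nat)
  also have "\<dots> \<le> 4 ^ n" by (rule prod_primes_atMost_le)
  finally have T: "prod (\<lambda>p. p ^ multiplicity p X) T \<le> 4 ^ n" .

  have "prod (\<lambda>p. p ^ multiplicity p X) S \<le> prod (\<lambda>_. 4 * n) S"
    by (intro prod_mono conjI pp) (auto simp: S_def)
  hence S1: "prod (\<lambda>p. p ^ multiplicity p X) S \<le> (4 * n) ^ card S" by simp
  \<comment> \<open>At most \<open>2 * sqrt n\<close> primes are small, and each contributes a power
    of at most \<open>4 * n\<close>.\<close>
  have "S \<subseteq> {1..nat \<lfloor>2 * sqrt n\<rfloor>}"
  proof
    fix p assume p: "p \<in> S"
    hence "real (p ^ 2) \<le> real (4 * n)" unfolding S_def of_nat_le_iff by simp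
    hence "real p ^ 2 \<le> (2 * sqrt n) ^ 2" by (simp add: power_mult_distrib)
    hence "real p \<le> 2 * sqrt n" by (rule power2_le_imp_le) simp
    moreover have "p \<ge> 1" using p by (intro prime_ge_1_nat) (auto simp: S_def)
    ultimately show "p \<in> {1..nat \<lfloor>2 * sqrt n\<rfloor>}" by (simp add: le_nat_floor)
  qed
  hence "card S \<le> nat \<lfloor>2 * sqrt n\<rfloor>" using card_mono[of "{1..nat \<lfloor>2 * sqrt n\<rfloor>}" S] by simp
  hence cS: "real (card S) \<le> 2 * sqrt n" by (simp add: le_nat_iff le_floor_iff)
  have "real ((4 * n) ^ card S) = (4 * real n) powr real (card S)"
    using n by (simp add: powr_realpow)
  also have "\<dots> \<le> (4 * real n) powr (2 * sqrt n)" using n cS by (intro powr_mono) auto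
  finally have S: "real (prod (\<lambda>p. p ^ multiplicity p X) S) \<le> (4 * real n) powr (2 * sqrt n)"
    using S1 by (meson of_nat_le_iff order_trans)

  have "X = (\<Prod>p\<in>prime_factors X. p ^ multiplicity p X)"
    using X0 by (intro prime_factorization_nat) auto
  also have "prime_factors X = S \<union> T" by (auto simp: S_def T_def)
  also have "(\<Prod>p\<in>S \<union> T. p ^ multiplicity p X) =
      prod (\<lambda>p. p ^ multiplicity p X) S * prod (\<lambda>p. p ^ multiplicity p X) T"
    by (intro prod.union_disjoint) (auto simp: S_def T_def)
  finally have "real X = real (prod (\<lambda>p. p ^ multiplicity p X) S) * real (prod (\<lambda>p. p ^ multiplicity p X) T)"
    by (metis of_nat_mult)
  also have "\<dots> \<le> (4 * real n) powr (2 * sqrt n) * real (4 ^ n)"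
    using T by (intro mult_mono S) (auto simp only: of_nat_le_iff of_nat_0_le_iff powr_ge_zero)
  finally show ?thesis by (simp add: X_def)
qed

lemma eventually_prime_between:
  "eventually (\<lambda>n::nat. \<exists>p. prime p \<and> n < p \<and> p \<le> 4 * n) at_top"
proof -
  \<comment> \<open>The right side is the lower bound \<open>4 ^ m / (2 * m)\<close> for
    \<open>2 * m choose m\<close> at \<open>m = 2 * n\<close>. The left side is \<open>4 ^ n\<close>
    times a subexponential factor.\<close>
  have "eventually (\<lambda>n::nat. (4 * real n) powr (2 * sqrt n) * 4 ^ n < 16 ^ n / (4 * real n)) at_top"
    by real_asymp
  thus ?thesis using eventually_ge_at_top[of 1]
  proof eventually_elim
    case (elim n)
    show ?case
    proof (rule ccontr)
      assume "\<not> ?case"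
      hence "real (4 * n choose (2 * n)) \<le> (4 * real n) powr (2 * sqrt n) * 4 ^ n"
        using elim by (intro central_binomial_le_if_no_prime) auto
      moreover have "16 ^ n / (4 * real n) \<le> real (4 * n choose (2 * n))"
        using central_binomial_lower_bound[of "2 * n"] elim by (simp add: power_mult)
      ultimately show False using elim by linarith
    qed
  qed
qed

lemma prime_in_bounded_ratio:
  obtains B :: nat where "B \<ge> 1" "\<And>n. n \<ge> 1 \<Longrightarrow> \<exists>p. prime p \<and> n \<le> p \<and> p \<le> B * n"
proof -
  obtain n0 where n0: "\<And>n::nat. n \<ge> n0 \<Longrightarrow> \<exists>p. prime p \<and> n < p \<and> p \<le> 4 * n"
    using eventually_prime_between by (auto simp: eventually_at_top_linorder)
  \<comment> \<open>This single prime serves every \<open>n < n0\<close>, as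
    \<open>n \<le> q \<le> q * n\<close>.\<close>
  obtain q where q: "prime q" "q > n0" using bigger_prime by blast
  show ?thesis
  proof (rule that[of "max 4 q"])
    fix n :: nat assume n: "n \<ge> 1"
    show "\<exists>p. prime p \<and> n \<le> p \<and> p \<le> max 4 q * n"
    proof (cases "n \<ge> n0")
      case True
      then obtain p where "prime p" "n < p" "p \<le> 4 * n" using n0 by blast
      moreover have "4 * n \<le> max 4 q * n" by (intro mult_right_mono) auto
      ultimately show ?thesis by (intro exI[of _ p] conjI) linarith+
    next
      case False
      have "q * 1 \<le> max 4 q * n" using n by (intro mult_mono) auto
      thus ?thesis using False q by (intro exI[of _ q]) auto
    qed
  qed auto
qed

section \<open>The optimal degree\<close>

text \<open>For \<open>D \<ge> log\<^sub>2 M\<close> the condition \<open>M \<le> p ^ (D + 1)\<close> is vacuous, so that the block size is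
  comparable to the number of blocks.\<close>

lemma code_qubits_le:
  assumes B: "\<And>n. n \<ge> 1 \<Longrightarrow> \<exists>p. prime p \<and> n \<le> p \<and> p \<le> B * n" and D: "M \<le> 2 ^ D"
  shows "code_qubits F M D \<le> B * code_blocks F M D ^ 2"
proof -
  obtain p where p: "prime p" "code_blocks F M D \<le> p" "p \<le> B * code_blocks F M D"
    using B[of "code_blocks F M D"] by (auto simp: code_blocks_def)
  have "M \<le> 2 ^ (D + 1)" using D by simp
  also have "\<dots> \<le> p ^ (D + 1)" using prime_ge_2_nat[OF p(1)] by (intro power_mono) auto
  finally have "code_block_size F M D \<le> p"
    unfolding code_block_size_def using p by (intro Least_le) auto
  also note p(3)
  finally show ?thesis
    by (simp add: code_qubits_def power2_eq_square mult_le_mono1 flip: mult.assoc)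
qed

lemma code_blocks_square_le: "code_blocks F M D ^ 2 \<le> code_qubits F M D"
  using code_block_size(2)[of F M D] by (simp add: code_qubits_def power2_eq_square)

theorem theorem1:
  "\<exists>C K :: real. C > 0 \<and> K > 0 \<and>
     (\<forall>F M D :: nat.
        F \<ge> 1 \<longrightarrow> M \<ge> 2 \<longrightarrow> real M \<ge> K * real F \<longrightarrow>
        is_arg_min (code_qubits F M) (\<lambda>D'. D' \<ge> 1) D \<longrightarrow>
          real (code_qubits F M D) \<le> C * (real F)\<^sup>2 * ln (real M) ^ 4 \<and>
          real D \<le> C * ln (real M))"
proof -
  obtain B :: nat where B1: "B \<ge> 1"
    and B: "\<And>n. n \<ge> 1 \<Longrightarrow> \<exists>p. prime p \<and> n \<le> p \<and> p \<le> B * n"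
    using prime_in_bounded_ratio by blast
  \<comment> \<open>\<open>B\<close> bounds the prime gap ratio, \<open>9 = 3 ^ 2\<close> comes from
    \<open>L \<le> 3 * F * w ^ 2\<close>, and \<open>6 ^ 4\<close> from
    \<open>w \<le> 6 * ln M\<close>.\<close>
  define C where "C = real B * 9 * 6 ^ 4"
  have "real (code_qubits F M D) \<le> C * (real F)\<^sup>2 * ln (real M) ^ 4 \<and> real D \<le> C * ln (real M)"
    if F: "F \<ge> 1" and M: "M \<ge> 2" and D: "is_arg_min (code_qubits F M) (\<lambda>D'. D' \<ge> 1) D" for F M D
  proof -
    \<comment> \<open>\<open>w\<close> has two roles: \<open>F * w\<close> is the code weight, and
      \<open>w\<close> itself is the degree compared with the optimal one.\<close>
    define w where "w = nat \<lceil>log 2 (real M + 1)\<rceil>"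
    have "log 2 (real M + 1) > 1" using M by simp
    hence w1: "w \<ge> 1" and w_ge: "real w \<ge> log 2 (real M + 1)"
      and w_le: "real w \<le> log 2 (real M + 1) + 1" unfolding w_def by linarith+
    have "real M + 1 \<le> 2 powr real w" using w_ge by (simp add: log_le_iff)
    moreover have "real (2 ^ w) = 2 powr real w" by (simp add: powr_realpow)
    ultimately have "real M \<le> real (2 ^ w)" by linarith
    hence Mw: "M \<le> 2 ^ w" by (simp only: of_nat_le_iff)
    have "real M + 1 \<le> real M * real M"
      using M mult_right_mono[of 2 "real M" "real M"] by linarith
    hence "log 2 (real M + 1) \<le> log 2 (real M * real M)" using M by simp
    also have "\<dots> = log 2 (real M) + log 2 (real M)"
      using M by (simp add: log_mult)
    finally have "log 2 (real M + 1) \<le> 2 * log 2 (real M)" by simp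
    moreover have "1 \<le> log 2 (real M)" using M by simp
    ultimately have "real w \<le> 3 * log 2 (real M)" using w_le by linarith
    also have "\<dots> = 3 / ln 2 * ln (real M)" by (simp add: log_def)
    \<comment> \<open>\<open>ln 2 \<ge> 1/2\<close> follows from \<open>ln x \<le> x - 1\<close> at
      \<open>x = 1/2\<close>.\<close>
    also have "\<dots> \<le> 6 * ln (real M)"
      using M ln_le_minus_one[of "1 / 2"] by (intro mult_right_mono) (auto simp: field_simps ln_div)
    finally have w6: "real w \<le> 6 * ln (real M)" .
    have "code_blocks F M w \<le> 3 * F * w ^ 2"
    proof -
      have "1 \<le> F * w ^ 2" using F w1 by simp
      thus ?thesis by (simp add: code_blocks_def code_weight_def power2_eq_square flip: w_def)
    qed
    hence "B * code_blocks F M w ^ 2 \<le> B * (3 * F * w ^ 2) ^ 2"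
      by (intro mult_left_mono power_mono) auto
    moreover have "code_qubits F M D \<le> code_qubits F M w"
      using D w1 by (auto simp: is_arg_min_linorder)
    ultimately have Q: "code_qubits F M D \<le> B * (3 * F * w ^ 2) ^ 2"
      using code_qubits_le[OF B Mw, of F] by linarith
    have "real (code_qubits F M D) \<le> real (B * (3 * F * w ^ 2) ^ 2)" using Q by (simp only: of_nat_le_iff)
    also have "\<dots> = real B * 9 * real F ^ 2 * real w ^ 4"
      by (simp add: power_mult_distrib flip: power_mult)
    also have "\<dots> \<le> real B * 9 * real F ^ 2 * (6 * ln (real M)) ^ 4"
      using w6 by (intro mult_left_mono power_mono) auto
    also have "\<dots> = C * (real F)\<^sup>2 * ln (real M) ^ 4" by (simp add: C_def power_mult_distrib)
    finally have 1: "real (code_qubits F M D) \<le> C * (real F)\<^sup>2 * ln (real M) ^ 4" .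
    \<comment> \<open>The number of blocks grows linearly in \<open>D\<close>, so the bound on the
      qubits also bounds \<open>D\<close>.\<close>
    have "(D * F * w) ^ 2 \<le> code_blocks F M D ^ 2"
      by (intro power_mono) (auto simp: code_blocks_def code_weight_def simp flip: w_def)
    also have "\<dots> \<le> B * (3 * F * w ^ 2) ^ 2"
      using code_blocks_square_le Q by (rule order_trans)
    \<comment> \<open>Enlarging \<open>B\<close> to \<open>B ^ 2\<close> makes the right side a
      perfect square, so that square roots can be taken in the naturals.\<close>
    also have "\<dots> \<le> B ^ 2 * (3 * F * w ^ 2) ^ 2"
      using B1 by (intro mult_right_mono) (auto simp: power2_eq_square)
    also have "\<dots> = (B * 3 * w * (F * w)) ^ 2" by (simp add: power2_eq_square)
    finally have "D * F * w \<le> B * 3 * w * (F * w)" by (rule power2_le_imp_le) simp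
    hence "D * (F * w) \<le> B * 3 * w * (F * w)" by (simp only: mult.assoc)
    hence "D \<le> B * 3 * w" using F w1 by (simp only: mult_le_cancel2) auto
    hence "real D \<le> real B * 3 * real w" by (metis of_nat_le_iff of_nat_mult of_nat_numeral)
    also have "\<dots> \<le> real B * 3 * (6 * ln (real M))" using w6 by (intro mult_left_mono) auto
    also have "\<dots> = real B * 18 * ln (real M)" by simp
    also have "\<dots> \<le> C * ln (real M)" unfolding C_def using M by (intro mult_right_mono) auto
    finally show ?thesis using 1 by blast
  qed
  moreover have "C > 0" using B1 by (simp add: C_def)
  ultimately show ?thesis by (intro exI[of _ C] exI[of _ 1]) auto
qed

end
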